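(* Let $X$ be a rank-one subshift with cut sequence $(r_n)$ and spacer sequence $(s_{n,i})$, and suppose there is a positive integer $d$ such that for all sufficiently large $n$: $s_{n,r_n}=0$, $s_{n,i}\in\{0,d\}$ for all $0\le i<r_n$, and $s_{n,i}$ is not constant over $0\le i<r_n$. Then its complexity function satisfies $\limsup_{q\to\infty}\big(p(q)-1.5q\big)=\infty$.
   Context: A rank-one subshift with cut sequence $(r_n)_{n\ge1}$ (positive integers) and spacer sequence $(s_{n,i})_{n\ge1,\,0\le i\le r_n}$ (nonnegative integers) is defined by $B_1=0$, $B_{n+1}=B_n1^{s_{n,0}}B_n1^{s_{n,1}}\cdots B_n1^{s_{n,r_n}}$; it is the set of $x\in\{0,1\}^{\mathbb Z}$ all of whose finite subwords are subwords of some $B_n$. The complexity $p(q)$ is the number of distinct words of length $q$ occurring in elements of the subshift. *)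

theory Defs
  imports Complex_Main "HOL-Library.Sublist" "HOL-Library.Liminf_Limsup" "HOL-Library.Extended_Real"
begin

text \<open>Rank-one words. r n is the n-th cut parameter and s n i the spacers (n \<ge> 1).
  blk r s k is the word B_(k+1); letters are the naturals 0 and 1.\<close>
fun blk :: "(nat \<Rightarrow> nat) \<Rightarrow> (nat \<Rightarrow> nat \<Rightarrow> nat) \<Rightarrow> nat \<Rightarrow> nat list" where
  "blk r s 0 = [0]"
| "blk r s (Suc k) =
     concat (map (\<lambda>i. blk r s k @ replicate (s (Suc k) i) 1) [0..<Suc (r (Suc k))])"

definition B :: "(nat \<Rightarrow> nat) \<Rightarrow> (nat \<Rightarrow> nat \<Rightarrow> nat) \<Rightarrow> nat \<Rightarrow> nat list" where
  "B r s n = blk r s (n - 1)"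

definition win :: "(int \<Rightarrow> nat) \<Rightarrow> int \<Rightarrow> nat \<Rightarrow> nat list" where
  "win x i q = map (\<lambda>j. x (i + int j)) [0..<q]"

definition rank_one_subshift :: "(nat \<Rightarrow> nat) \<Rightarrow> (nat \<Rightarrow> nat \<Rightarrow> nat) \<Rightarrow> (int \<Rightarrow> nat) set" where
  "rank_one_subshift r s =
     {x. (\<forall>i. x i \<in> {0, 1}) \<and>
         (\<forall>i q. \<exists>n\<ge>1. sublist (win x i q) (B r s n))}"

definition complexity :: "(int \<Rightarrow> nat) set \<Rightarrow> nat \<Rightarrow> nat" where
  "complexity X q = card {w. length w = q \<and> (\<exists>x\<in>X. \<exists>i. w = win x i q)}"

end

theory Submission
  imports Defs
begin

text \<open>
  The complexity grows from q to q + 1 by the number of right-special words of length q (those that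
  can be followed by both letters). The suffixes of the blocks are right-special, one for each length,
  so only the surplus f over 1 matters. It suffices to find, for every level n with block length h_n,
  some q \<ge> h_n with 2 * (sum of f over [h_n, q)) \<ge> q - K where K is independent of n: the surpluses of lower levels
  then accumulate without bound.

  Fix a level with block C and pattern Y of spacers, where a = hd Y and b is the other spacer, so that
  Y = a^k b ... b a^t with k > 0. The pattern occurs in the language as Y a Y and as Y b Y.
  If k > t, the run a^(t+k) is right-special and leaves the suffix branch at a^t. If k < t, comparing Y
  with Y shifted by k + 1 yields a right-special a^t b g whose final run of a is shorter than t.
  If k = t, the run a^(2k) falls short by half a block, and any interior run in Y whose length is
  neither k nor 2k + 1 produces the missing right-special words. Otherwise every run has length
  k or 2k + 1, so Y consists of words a^k separated by single spacers; passing to the longer block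
  C a C ... a C (k + 1 copies of C) gives a new level, and what a^(2k) has contributed
  compensates for the half-block deficit of the new level.
\<close>

section \<open>Words woven from a block and spacers\<close>

text \<open>Steps of length p from the left of n land below n + p, so they cannot jump over the
  window [n, n + p), whose value a is carried back along them.\<close>

lemma run_backwards:
  assumes per: "\<And>i. i < m \<Longrightarrow> Y ! i = Y ! (i + p)"
    and run: "\<And>j. n \<le> j \<Longrightarrow> j < n + p \<Longrightarrow> Y ! j = a"
    and "n \<le> m" "p > 0" "j < n + p"
  shows "Y ! j = a"
  using assms(5)
proof (induction "n - j" arbitrary: j rule: less_induct)
  case less
  show ?case
  proof (cases "n \<le> j")
    case False
    hence "Y ! (j + p) = a" using \<open>p > 0\<close> by (intro less.hyps) auto
    thus ?thesis using False per[of j] \<open>n \<le> m\<close> by simp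
  qed (use run less.prems in auto)
qed

text \<open>Spacers stand only between copies of C, as in a block whose last spacer is 0.\<close>

definition weave :: "nat list \<Rightarrow> nat list \<Rightarrow> nat list" where
  "weave C cs = C @ concat (map (\<lambda>c. replicate c 1 @ C) cs)"

definition interleave :: "nat list \<Rightarrow> nat list \<Rightarrow> nat list" where
  "interleave Q zs = Q @ concat (map (\<lambda>z. z # Q) zs)"

definition suf :: "nat \<Rightarrow> 'a list \<Rightarrow> 'a list" where
  "suf l w = drop (length w - l) w"

lemma weave_Nil [simp]: "weave C [] = C"
  by (simp add: weave_def)

lemma weave_Cons: "weave C (c # cs) = C @ replicate c 1 @ weave C cs"
  by (simp add: weave_def)

lemma weave_append: "weave C (p @ x # r) = weave C p @ replicate x 1 @ weave C r"
  by (simp add: weave_def)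

lemma weave_append2: "weave C (p @ r) = weave C p @ concat (map (\<lambda>c. replicate c 1 @ C) r)"
  by (simp add: weave_def)

lemma length_weave: "length (weave C cs) = (length cs + 1) * length C + sum_list cs"
  by (induction cs) (auto simp: weave_def)

lemma interleave_Nil [simp]: "interleave Q [] = Q"
  by (simp add: interleave_def)

lemma interleave_Cons: "interleave Q (z # zs) = Q @ z # interleave Q zs"
  by (simp add: interleave_def)

lemma interleave_append: "interleave Q (p @ x # r) = interleave Q p @ x # interleave Q r"
  by (simp add: interleave_def)

text \<open>This permits regrouping: a pattern made of copies of Q with single separators becomes
  the pattern of separators over the longer block \<open>weave C Q\<close>.\<close>

lemma weave_interleave: "weave C (interleave Q zs) = weave (weave C Q) zs"
  by (induction zs) (simp_all add: interleave_Cons weave_Cons weave_append)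

lemma sublist_weave:
  assumes "sublist p r"
  shows "sublist (weave C p) (weave C r)"
proof -
  from assms obtain u v where r: "r = u @ p @ v" by (auto simp: sublist_def)
  have "sublist (weave C p) (weave C (p @ v))"
    unfolding weave_append2 by simp
  moreover have "sublist (weave C q) (weave C (u @ q))" for q
  proof (induction u)
    case (Cons x u)
    thus ?case by (simp add: weave_Cons sublist_append)
  qed simp
  ultimately show ?thesis unfolding r using sublist_order.order_trans by blast
qed

section \<open>Suffixes of prescribed length\<close>

lemma length_suf [simp]: "l \<le> length w \<Longrightarrow> length (suf l w) = l"
  by (simp add: suf_def)

lemma suf_append [simp]: "l \<le> length v \<Longrightarrow> suf l (u @ v) = suf l v"
  by (simp add: suf_def)

lemma suf_plus: "suf (n + length v) (u @ v) = suf n u @ v"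
  by (simp add: suf_def)

lemma suf_length [simp]: "suf (length w) w = w"
  by (simp add: suf_def)

lemma suf_suf: "s \<le> l \<Longrightarrow> l \<le> length w \<Longrightarrow> suf s (suf l w) = suf s w"
  by (simp add: suf_def)

lemma suffix_suf: "suffix (suf l w) w"
  by (simp add: suf_def suffix_drop)

lemma suf_mono: "suf l u = suf l v \<Longrightarrow> s \<le> l \<Longrightarrow> l \<le> length u \<Longrightarrow> l \<le> length v
    \<Longrightarrow> suf s u = suf s v"
  by (metis suf_suf)

text \<open>Count zeros: the window at the end loses the leading 0 of w and gains only ones.\<close>

lemma suf_append_ones_neq:
  assumes "w \<noteq> []" "hd w = (0::nat)" "d > 0"
  shows "suf (length w) (u @ w @ replicate d 1) \<noteq> w"
proof
  assume *: "suf (length w) (u @ w @ replicate d 1) = w"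
  obtain v where w: "w = 0 # v" using assms by (cases w) auto
  have "suf (length w) (u @ w @ replicate d 1) = suf (length w) (w @ replicate d 1)"
    by simp
  also have "\<dots> = drop d (w @ replicate d 1)" by (simp add: suf_def)
  also have "\<dots> = drop (d - 1) (v @ replicate d 1)"
    using assms(3) by (cases d) (auto simp: w)
  finally have "w = drop (d - 1) (v @ replicate d 1)" using * by simp
  hence "count_list w 0 = count_list (drop (d - 1) (v @ replicate d 1)) 0" by simp
  also have "\<dots> \<le> count_list (v @ replicate d 1) 0"
    by (metis append_take_drop_id count_list_append le_add2)
  also have "\<dots> = count_list v 0"
    using count_notin[of 0 "replicate d (1::nat)"] by (simp add: count_list_append)
  also have "\<dots> < count_list w 0" by (simp add: w)
  finally show False by simp
qed

section \<open>Right-special words\<close>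

text \<open>The tail of a rank-one construction from a stage on where the spacer hypotheses hold;
  \<open>P k\<close> omits the final spacer 0.\<close>

locale tower =
  fixes B P :: "nat \<Rightarrow> nat list" and d :: nat
  assumes B_Suc: "B (Suc k) = weave (B k) (P k)"
    and set_P: "set (P k) = {0, d}"
    and d_pos: "d > 0"
    and B0_binary: "set (B 0) \<subseteq> {0, 1}"
    and B0_ne: "B 0 \<noteq> []"
    and B0_hd: "hd (B 0) = 0"
begin

definition lang :: "nat list set" where
  "lang = {w. \<exists>k. sublist w (B k)}"

definition rspecial :: "nat list \<Rightarrow> bool" where
  "rspecial w \<longleftrightarrow> w @ [0] \<in> lang \<and> w @ [1] \<in> lang"

definition RS :: "nat \<Rightarrow> nat list set" where
  "RS l = {w. length w = l \<and> rspecial w}"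

text \<open>Each block is a suffix of the next, so the blocks converge to a left-infinite word,
  whose suffix of length l this is. The block \<open>B l\<close> serves because it has more than l
  letters.\<close>

definition lim_suf :: "nat \<Rightarrow> nat list" where
  "lim_suf l = suf l (B l)"

lemma lang_sublist: "w \<in> lang \<Longrightarrow> sublist v w \<Longrightarrow> v \<in> lang"
  unfolding lang_def using sublist_order.order_trans by blast

lemma B_binary: "set (B k) \<subseteq> {0, 1}"
  by (induction k) (use B0_binary in \<open>auto simp: B_Suc weave_def\<close>)

lemma lang_binary: "w \<in> lang \<Longrightarrow> set w \<subseteq> {0, 1}"
  unfolding lang_def using B_binary set_mono_sublist by blast

lemma B_ne: "B k \<noteq> []"
  by (induction k) (auto simp: B0_ne B_Suc weave_def)

lemma B_hd: "hd (B k) = 0"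
  by (induction k) (auto simp: B0_hd B_Suc weave_def B_ne hd_append)

lemma P_ne: "P k \<noteq> []"
  using set_P[of k] by auto

lemma suffix_B_Suc: "\<exists>u. u \<noteq> [] \<and> B (Suc k) = u @ B k"
proof -
  obtain p x where "P k = p @ [x]" using P_ne by (metis rev_exhaust)
  hence "B (Suc k) = (weave (B k) p @ replicate x 1) @ B k" by (simp add: B_Suc weave_append)
  moreover have "weave (B k) p \<noteq> []" using B_ne by (simp add: weave_def)
  ultimately show ?thesis by blast
qed

lemma suffix_B: "k \<le> m \<Longrightarrow> \<exists>u. B m = u @ B k"
proof (induction rule: dec_induct)
  case (step n)
  thus ?case using suffix_B_Suc[of n] by (metis append.assoc)
qed simp

lemma length_B: "length (B k) > k"
proof (induction k)
  case (Suc k)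
  obtain u where "u \<noteq> []" "B (Suc k) = u @ B k" using suffix_B_Suc by blast
  moreover from this have "length u > 0" by simp
  ultimately show ?case using Suc by (simp only: length_append)
qed (use B0_ne in simp)

lemma length_B_mono: "k \<le> m \<Longrightarrow> length (B k) \<le> length (B m)"
  using suffix_B by fastforce

lemma lim_suf_eq: "l \<le> length (B k) \<Longrightarrow> lim_suf l = suf l (B k)"
proof (cases "k \<le> l")
  case True
  assume l: "l \<le> length (B k)"
  obtain u where "B l = u @ B k" using suffix_B True by blast
  thus ?thesis using l by (simp add: lim_suf_def)
next
  case False
  hence "l \<le> k" by simp
  then obtain u where "B k = u @ B l" using suffix_B by blast
  thus ?thesis using length_B[of l] by (simp add: lim_suf_def)
qed

lemma suf_lim_suf: "s \<le> l \<Longrightarrow> suf s (lim_suf l) = lim_suf s"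
  using length_B[of l] by (simp add: lim_suf_def suf_suf lim_suf_eq[of s l, unfolded lim_suf_def])

lemma length_lim_suf [simp]: "length (lim_suf l) = l"
  using length_B[of l] by (simp add: lim_suf_def)

lemma rspecial_suffix: "rspecial w \<Longrightarrow> suffix v w \<Longrightarrow> rspecial v"
  unfolding rspecial_def
  by (auto simp: suffix_def intro: lang_sublist)

text \<open>C begins with 0, so a following spacer 0 shows the letter 0, while the spacer d > 0
  shows the letter 1.\<close>

lemma rspecial_weave:
  assumes C: "C \<noteq> []" "hd C = 0" and "weave C (cs @ [0]) \<in> lang" "weave C (cs @ [d]) \<in> lang"
  shows "rspecial (weave C cs)"
proof -
  obtain C' where C': "C = 0 # C'" using C by (cases C) auto
  have "sublist (weave C cs @ [0]) (weave C (cs @ [0]))"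
    by (simp add: weave_append2 C' sublist_append_leftI)
  moreover obtain e where "d = Suc e" using d_pos by (cases d) auto
  hence "sublist (weave C cs @ [1]) (weave C (cs @ [d]))"
    by (simp add: weave_append2 sublist_append_leftI)
  ultimately show ?thesis
    unfolding rspecial_def using assms lang_sublist by blast
qed

lemma B_pair_in_lang:
  assumes "z \<in> {0, d}"
  shows "B k @ replicate z 1 @ B k \<in> lang"
proof -
  have "z \<in> set (P k)" using assms set_P by simp
  then obtain u v where "P k = u @ z # v" by (meson split_list)
  hence "sublist [z] (P k)" by (metis sublist_appendI append_Cons append_Nil)
  hence "sublist (weave (B k) [z]) (B (Suc k))" unfolding B_Suc by (rule sublist_weave)
  thus ?thesis unfolding lang_def by (auto simp: weave_Cons)
qed

lemma rspecial_B: "rspecial (B k)"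
  using rspecial_weave[of "B k" "[]"] B_pair_in_lang[of 0 k] B_pair_in_lang[of d k] B_ne B_hd
  by (simp add: weave_Cons)

lemma lim_suf_in_RS: "lim_suf l \<in> RS l"
  unfolding RS_def using rspecial_suffix[OF rspecial_B suffix_suf] length_lim_suf[of l]
  unfolding lim_suf_def by blast

section \<open>Counting words by their right-special prefixes\<close>

lemma finite_words: "finite {w. length w = l \<and> w \<in> lang}"
proof (rule finite_subset)
  show "{w. length w = l \<and> w \<in> lang} \<subseteq> {w. set w \<subseteq> {0,1} \<and> length w = l}"
    using lang_binary by auto
  show "finite {w. set w \<subseteq> {0,1::nat} \<and> length w = l}" by (rule finite_lists_length_eq) simp
qed

lemma RS_subset: "RS l \<subseteq> {w. length w = l \<and> w \<in> lang}"
  unfolding RS_def rspecial_def using lang_sublist by (auto intro: lang_sublist)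

lemma finite_RS: "finite (RS l)"
  using RS_subset finite_words finite_subset by blast

text \<open>A block followed by 0 is again in the language, so a word inside a block always has a
  letter after it.\<close>

lemma lang_extend: 
  assumes "w \<in> lang"
  shows "w @ [0] \<in> lang \<or> w @ [1] \<in> lang"
proof -
  obtain k u v where k: "B k = u @ w @ v" using assms by (auto simp: lang_def sublist_def)
  have "B k @ [0] \<in> lang" using rspecial_B by (simp add: rspecial_def)
  hence *: "w @ v @ [0] \<in> lang" using k by (auto intro: lang_sublist)
  obtain x y where xy: "v @ [0] = x # y" by (cases "v @ [0]") auto
  have "sublist (w @ [x]) (w @ v @ [0])" unfolding xy by (simp add: sublist_append_leftI)
  hence "w @ [x] \<in> lang" using * lang_sublist by blast
  thus ?thesis using lang_binary[of "w @ [x]"] by auto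
qed

text \<open>Split the words of length l by the letters that may follow: the two classes cover all of
  them and overlap exactly in \<open>RS l\<close>.\<close>

lemma card_words_Suc:
  "card {w. length w = l \<and> w \<in> lang} + card (RS l) \<le> card {w. length w = Suc l \<and> w \<in> lang}"
proof -
  define A where "A c = {w. length w = l \<and> w @ [c] \<in> lang}" for c
  have sub: "A c \<subseteq> {w. length w = l \<and> w \<in> lang}" for c
    unfolding A_def using lang_sublist by (auto intro: lang_sublist)
  have fin: "finite (A c)" for c using sub finite_words finite_subset by blast
  have un: "A 0 \<union> A 1 = {w. length w = l \<and> w \<in> lang}"
    using sub lang_extend by (auto simp: A_def)
  have int: "A 0 \<inter> A 1 = RS l" by (auto simp: A_def RS_def rspecial_def)
  have inj: "inj_on (\<lambda>w. w @ [c]) (A c)" for c :: nat by (auto simp: inj_on_def)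
  have "card {w. length w = l \<and> w \<in> lang} + card (RS l) = card (A 0) + card (A 1)"
    using card_Un_Int[OF fin fin, of 0 1] un int by simp
  also have "\<dots> = card ((\<lambda>w. w @ [0]) ` A 0) + card ((\<lambda>w. w @ [1]) ` A 1)"
    using inj by (simp add: card_image)
  also have "\<dots> = card ((\<lambda>w. w @ [0]) ` A 0 \<union> (\<lambda>w. w @ [1]) ` A 1)"
    by (rule card_Un_disjoint[symmetric]) (auto simp: fin)
  also have "\<dots> \<le> card {w. length w = Suc l \<and> w \<in> lang}"
    by (rule card_mono[OF finite_words]) (auto simp: A_def)
  finally show ?thesis .
qed

lemma card_RS_pos: "card (RS l) \<ge> 1"
  using lim_suf_in_RS[of l] finite_RS[of l] by (metis One_nat_def Suc_leI card_gt_0_iff empty_iff)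

lemma card_words_ge:
  "q + (\<Sum>l<q. card (RS l) - 1) \<le> card {w. length w = q \<and> w \<in> lang}"
proof (induction q)
  case (Suc q)
  thus ?case using card_words_Suc[of q] card_RS_pos[of q] by simp
qed simp

text \<open>Suffixes of right-special words are right-special, and a difference at one length
  persists at greater lengths. So w1 and w2 carry branches from s1 and s2 on, distinct from
  \<open>lim_suf\<close> and from each other. The implications admit empty branches.\<close>

lemma card_RS_ge:
  assumes w1: "rspecial w1" and w2: "rspecial w2"
    and d1: "s1 \<le> length w1 \<longrightarrow> suf s1 w1 \<noteq> lim_suf s1"
    and d2: "s2 \<le> length w2 \<longrightarrow> suf s2 w2 \<noteq> lim_suf s2"
    and d12: "s2 \<le> length w2 \<longrightarrow> s2 \<le> length w1 \<longrightarrow> suf s2 w1 \<noteq> suf s2 w2"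
  shows "of_bool (l \<in> {s1..length w1}) + of_bool (l \<in> {s2..length w2}) \<le> card (RS l) - 1"
proof -
  have RS: "rspecial w \<Longrightarrow> l \<le> length w \<Longrightarrow> suf l w \<in> RS l" for w
    using rspecial_suffix[OF _ suffix_suf] by (simp add: RS_def)
  have L: "suf l w \<noteq> lim_suf l" if "suf s w \<noteq> lim_suf s" "s \<le> l" "l \<le> length w" for w s
    using that by (metis suf_lim_suf suf_suf)
  have M: "card M \<le> card (RS l)" if "M \<subseteq> RS l" for M
    using that finite_RS card_mono by blast
  consider "l \<in> {s1..length w1}" "l \<in> {s2..length w2}" | "l \<in> {s1..length w1}" "l \<notin> {s2..length w2}"
    | "l \<notin> {s1..length w1}" "l \<in> {s2..length w2}" | "l \<notin> {s1..length w1}" "l \<notin> {s2..length w2}"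
    by blast
  thus ?thesis
  proof cases
    case 1
    hence "suf l w1 \<noteq> lim_suf l" "suf l w2 \<noteq> lim_suf l" using L d1 d2 by auto
    moreover have "suf l w1 \<noteq> suf l w2" using 1 d12 suf_mono[of l w1 w2 s2] by auto
    ultimately have "card {lim_suf l, suf l w1, suf l w2} = 3" by auto
    thus ?thesis using M[of "{lim_suf l, suf l w1, suf l w2}"] 1 RS w1 w2 lim_suf_in_RS by auto
  next
    case 2
    hence "suf l w1 \<noteq> lim_suf l" using L d1 by auto
    hence "card {lim_suf l, suf l w1} = 2" by auto
    thus ?thesis using M[of "{lim_suf l, suf l w1}"] 2 RS w1 lim_suf_in_RS by auto
  next
    case 3
    hence "suf l w2 \<noteq> lim_suf l" using L d2 by auto
    hence "card {lim_suf l, suf l w2} = 2" by auto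
    thus ?thesis using M[of "{lim_suf l, suf l w2}"] 3 RS w2 lim_suf_in_RS by auto
  next
    case 4
    thus ?thesis by (simp only: of_bool_eq simp_thms)
  qed
qed

lemma sum_RS_ge:
  assumes "rspecial w1" "rspecial w2"
    and "s1 \<le> length w1 \<longrightarrow> suf s1 w1 \<noteq> lim_suf s1"
    and "s2 \<le> length w2 \<longrightarrow> suf s2 w2 \<noteq> lim_suf s2"
    and "s2 \<le> length w2 \<longrightarrow> s2 \<le> length w1 \<longrightarrow> suf s2 w1 \<noteq> suf s2 w2"
    and "h \<le> s1" "h \<le> s2" "length w1 < q" "length w2 < q"
  shows "(length w1 + 1 - s1) + (length w2 + 1 - s2) \<le> (\<Sum>l=h..<q. card (RS l) - 1)"
proof -
  \<comment> \<open>For s > t both sides are 0, by the empty interval and by truncated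
    subtraction.\<close>
  have *: "(\<Sum>l=h..<q. of_bool (l \<in> {s..t})) = t + 1 - s" if "h \<le> s" "t < q" for s t :: nat
  proof -
    have "{h..<q} \<inter> {s..t} = {s..t}" using that by auto
    moreover have "(\<Sum>l=h..<q. of_bool (l \<in> {s..t})) = (\<Sum>l\<in>{h..<q} \<inter> {s..t}. (1::nat))"
      by (simp only: sum.inter_restrict[OF finite_atLeastLessThan] of_bool_def)
    ultimately show ?thesis by simp
  qed
  have "(length w1 + 1 - s1) + (length w2 + 1 - s2)
    = (\<Sum>l=h..<q. of_bool (l \<in> {s1..length w1}) + of_bool (l \<in> {s2..length w2}))"
    using *[of s1 "length w1"] *[of s2 "length w2"] assms(6-) by (simp add: sum.distrib)
  also have "\<dots> \<le> (\<Sum>l=h..<q. card (RS l) - 1)"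
    by (rule sum_mono card_RS_ge[OF assms(1-5)])+
  finally show ?thesis .
qed

section \<open>Surplus at one level\<close>

text \<open>The existential on B n makes the suffixes of weave C Y lie on the branch lim_suf.
  C need not be a block of the tower itself.\<close>

definition level :: "nat list \<Rightarrow> nat list \<Rightarrow> bool" where
  "level C Y \<longleftrightarrow> (\<exists>u. C = u @ B 0) \<and> hd C = 0 \<and> set Y = {0, d} \<and> (\<exists>n. weave C Y = B n) \<and>
     (\<forall>z\<in>{0, d}. weave C (Y @ z # Y) \<in> lang)"

text \<open>Starting the sum at h allows levels to contribute over disjoint ranges. The constant,
  independent of h, absorbs the delays with which branches separate.\<close>

definition good :: "nat \<Rightarrow> bool" where
  "good h \<longleftrightarrow> (\<exists>q\<ge>h. q \<le> 2 * (\<Sum>l=h..<q. card (RS l) - 1) + (4 * length (B 0) + d + 2))"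

lemma goodI2:
  assumes "rspecial w1" "rspecial w2"
    and "s1 \<le> length w1 \<longrightarrow> suf s1 w1 \<noteq> lim_suf s1"
    and "s2 \<le> length w2 \<longrightarrow> suf s2 w2 \<noteq> lim_suf s2"
    and "s2 \<le> length w2 \<longrightarrow> s2 \<le> length w1 \<longrightarrow> suf s2 w1 \<noteq> suf s2 w2"
    and "h \<le> s1" "h \<le> s2" "length w1 < q" "length w2 < q" "h \<le> length w1"
    and "q \<le> 2 * ((length w1 + 1 - s1) + (length w2 + 1 - s2)) + (4 * length (B 0) + d + 2)"
  shows "good h"
proof -
  have "h \<le> q" using assms(8,10) by simp
  moreover note sum_RS_ge[OF assms(1-9)]
  hence "q \<le> 2 * (\<Sum>l=h..<q. card (RS l) - 1) + (4 * length (B 0) + d + 2)"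
    using assms(11) by (meson add_le_mono1 mult_le_mono2 order_trans)
  ultimately show ?thesis unfolding good_def by blast
qed

text \<open>One branch suffices if it fills, up to the constant, the upper half of the lengths up to
  \<open>length w\<close>; the second branch is taken empty.\<close>

lemma goodI1:
  assumes "rspecial w" "suf s w \<noteq> lim_suf s" "h \<le> s" "h \<le> length w"
    and "2 * s \<le> length w + 4 * length (B 0) + d + 2"
  shows "good h"
proof (rule goodI2[of w w s "length w + 1" h "length w + 1"])
  show "length w + 1 \<le> 2 * (length w + 1 - s + (length w + 1 - (length w + 1))) + (4 * length (B 0) + d + 2)"
    using assms(5) by arith
qed (use assms in auto)

text \<open>Before the common part one word shows \<open>B 0\<close>, the other the end of
  \<open>B 0\<close> followed by d ones; counting zeros separates them. Using \<open>B 0\<close> in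
  place of C keeps the delay independent of the level.\<close>

lemma weave_diverge:
  assumes C: "C = u @ B 0" and xy: "x \<in> {0, d}" "y \<in> {0, d}" "x \<noteq> y"
  shows "suf (length (weave C cs) + length (B 0)) (weave C (p @ x # cs))
       \<noteq> suf (length (weave C cs) + length (B 0)) (weave C (p' @ y # cs))"
proof -
  have suffix: "\<exists>v. weave C p = v @ B 0" for p
    by (cases p rule: rev_cases) (auto simp: C weave_append)
  have *: "suf (length (weave C cs) + length (B 0)) (weave C (p @ 0 # cs))
       \<noteq> suf (length (weave C cs) + length (B 0)) (weave C (p' @ d # cs))" for p p'
  proof -
    obtain v v' where v: "weave C p = v @ B 0" "weave C p' = v' @ B 0" using suffix by metis
    have "suf (length (weave C cs) + length (B 0)) (weave C (p @ 0 # cs)) = B 0 @ weave C cs"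
      using suf_plus[of "length (B 0)" "weave C cs" "v @ B 0"]
      by (simp add: weave_append v add.commute)
    moreover have "suf (length (weave C cs) + length (B 0)) (weave C (p' @ d # cs))
        = suf (length (B 0)) (v' @ B 0 @ replicate d 1) @ weave C cs"
      using suf_plus[of "length (B 0)" "weave C cs" "v' @ B 0 @ replicate d 1"]
      by (simp add: weave_append v add.commute)
    ultimately show ?thesis using suf_append_ones_neq[OF B0_ne B0_hd d_pos] by (metis append_same_eq)
  qed
  show ?thesis using xy *[of p p'] *[of p' p] by auto
qed

section \<open>Initial and final runs of a spacer in a pattern\<close>

context
  fixes C Y :: "nat list" and a b :: nat
  assumes lv: "level C Y" and ab: "a \<noteq> b" "{a, b} = {0, d}"
begin

lemma level_C_ne: "C \<noteq> []"
  using lv B0_ne by (auto simp: level_def)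

text \<open>Words Y z Y are woven into the language for either z, so it is enough to see cs before
  both spacers inside such words.\<close>

lemma level_rspecial:
  assumes "Y @ z # Y = p @ cs @ x # q" "Y @ z' # Y = p' @ cs @ y # q'"
    and "{x, y} = {a, b}" "z \<in> {a, b}" "z' \<in> {a, b}"
  shows "rspecial (weave C cs)"
proof -
  have "sublist (cs @ [x]) (Y @ z # Y)" "sublist (cs @ [y]) (Y @ z' # Y)"
    using assms sublist_appendI[of "cs @ [x]" p q] sublist_appendI[of "cs @ [y]" p' q'] by simp_all
  moreover have "weave C (Y @ z # Y) \<in> lang" "weave C (Y @ z' # Y) \<in> lang"
    using assms(4,5) lv ab(2) by (auto simp: level_def)
  ultimately have "weave C (cs @ [x]) \<in> lang" "weave C (cs @ [y]) \<in> lang"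
    using sublist_weave lang_sublist by blast+
  hence "weave C (cs @ [0]) \<in> lang" "weave C (cs @ [d]) \<in> lang"
    using assms(3) ab by (auto simp: doubleton_eq_iff)
  thus ?thesis using rspecial_weave level_C_ne lv by (simp add: level_def)
qed

lemma level_diverge:
  assumes "x \<in> {a, b}" "y \<in> {a, b}" "x \<noteq> y"
  shows "suf (length (weave C cs) + length (B 0)) (weave C (p @ x # cs))
       \<noteq> suf (length (weave C cs) + length (B 0)) (weave C (p' @ y # cs))"
  using weave_diverge[of C _ x y cs p p'] assms ab lv unfolding level_def by auto

text \<open>\<open>weave C Y\<close> is a block, so the limit branch reads the end of Y; the other
  spacer in front of cs leaves it.\<close>

lemma level_diverge_lim:
  assumes "Y = p' @ y # cs" "x \<in> {a, b}" "y \<in> {a, b}" "x \<noteq> y"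
  shows "suf (length (weave C cs) + length (B 0)) (weave C (p @ x # cs))
       \<noteq> lim_suf (length (weave C cs) + length (B 0))"
proof -
  obtain n u where n: "weave C Y = B n" "C = u @ B 0" using lv by (auto simp: level_def)
  have "length (weave C cs) + length (B 0) \<le> length (weave C Y)"
    unfolding assms(1) by (auto simp: weave_append length_weave n(2))
  thus ?thesis
    using level_diverge[OF assms(2-4), of cs p p'] n(1) lim_suf_eq assms(1) by metis
qed

lemma good_if_head_longer:
  assumes hd: "Y = replicate k a @ b # rest" and tl: "Y = pre @ b # replicate t a"
    and kt: "t < k" and h: "h \<le> length C"
  shows "good h"
proof -
  define w where "w = weave C (replicate (t + k) a)"
  \<comment> \<open>The seam of Y a Y is a run of t + k + 1 letters a; its first t + k are followed
    by a, its last t + k by b.\<close>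
  have Y1: "Y @ a # Y = (pre @ [b]) @ replicate (t + k) a @ a # b # rest"
    by (subst (1) tl, subst hd) (simp add: replicate_add replicate_app_Cons_same)
  have Y2: "Y @ a # Y = (pre @ [b, a]) @ replicate (t + k) a @ b # rest"
    by (subst (1) tl, subst hd) (simp add: replicate_add replicate_app_Cons_same)
  have rs: "rspecial w" unfolding w_def
    by (rule level_rspecial[OF Y1 Y2]) auto
  have w': "replicate (t + k) a = replicate (k - 1) a @ a # replicate t a"
    using kt replicate_add[of "k - 1" "Suc t" a] by (simp add: add.commute)
  have "suf (length (weave C (replicate t a)) + length (B 0)) w
      \<noteq> lim_suf (length (weave C (replicate t a)) + length (B 0))"
    unfolding w_def w' by (rule level_diverge_lim[OF tl]) (use ab in auto)
  moreover have "2 * (length (weave C (replicate t a)) + length (B 0)) \<le> length w + 4 * length (B 0)"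
  proof -
    \<comment> \<open>The branch starts at t + 1 of t + k + 1 copies of C, at most half since t + 1
      \<le> k.\<close>
    have "(t + 1) * (length C + a) \<le> k * (length C + a)" using kt by (intro mult_le_mono1) simp
    thus ?thesis by (simp add: w_def length_weave sum_list_replicate algebra_simps)
  qed
  moreover have "h \<le> length (weave C (replicate t a)) + length (B 0)" "h \<le> length w"
    using h by (simp_all add: length_weave w_def)
  ultimately show ?thesis
    by (intro goodI1[OF rs, of "length (weave C (replicate t a)) + length (B 0)"]) linarith+
qed

lemma good_if_tail_longer:
  assumes hd: "Y = replicate k a @ b # rest" and tl: "Y = pre @ b # replicate t a"
    and kt: "k < t" and h: "h \<le> length C"
  shows "good h"
proof -
  define mismatch where "mismatch i \<longleftrightarrow> i + Suc k < length Y \<and> Y ! i \<noteq> Y ! (i + Suc k)" for i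
  have Yk: "Y ! k = b" "k < length Y" unfolding hd by (simp_all add: nth_append)
  have len: "length Y = Suc (length pre + t)" unfolding tl by simp
  have Yt: "Y ! i = a" if "length pre < i" "i < length Y" for i
    using that len unfolding tl by (simp add: nth_append nth_Cons')
  \<comment> \<open>Otherwise Y has period k + 1, and its last k + 1 letters, all a since k < t,
    would force a at position k, which holds b.\<close>
  have "\<exists>i. mismatch i"
  proof (rule ccontr)
    assume *: "\<nexists>i. mismatch i"
    have "Y ! k = a"
      by (rule run_backwards[of "length Y - Suc k" Y "Suc k" "length Y - Suc k"])
        (use * Yk Yt len kt in \<open>auto simp: mismatch_def less_diff_conv\<close>)
    thus False using Yk ab by simp
  qed
  define m where "m = (LEAST i. mismatch i)"
  have m: "mismatch m" unfolding m_def using \<open>\<exists>i. mismatch i\<close> by (rule LeastI_ex)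
  hence mlen: "m + Suc k < length Y" by (simp add: mismatch_def)
  have per: "Y ! i = Y ! (i + Suc k)" if "i < m" for i
    using not_less_Least[of i mismatch] that mlen unfolding m_def mismatch_def by auto
  define g where "g = take m Y"
  have Yab: "set Y = {a, b}" using lv ab by (simp add: level_def)
  have Y_g: "Y = g @ Y ! m # drop (Suc m) Y"
    unfolding g_def using mlen by (intro id_take_nth_drop) simp
  have rest: "rest = drop (Suc k) Y" by (simp add: hd)
  obtain rest' where rest_g: "rest = g @ Y ! (m + Suc k) # rest'"
  proof -
    have "take m rest = g" unfolding g_def rest using per mlen
      by (intro nth_equalityI) (auto simp: add.commute)
    moreover have "rest ! m = Y ! (m + Suc k)" "m < length rest"
      unfolding rest using mlen by (simp_all add: add.commute)
    ultimately have "rest = g @ Y ! (m + Suc k) # drop (Suc m) rest"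
      using id_take_nth_drop[of m rest] by simp
    thus ?thesis by (rule that)
  qed
  have ne: "Y ! m \<noteq> Y ! (m + Suc k)" using m by (simp add: mismatch_def)
  have mem: "Y ! m \<in> {a, b}" "Y ! (m + Suc k) \<in> {a, b}" 
    using nth_mem[of m Y] nth_mem[of "m + Suc k" Y] mlen unfolding Yab by simp_all
  \<comment> \<open>Behind a^t b, the word g begins the second Y in Y b Y, and begins
    \<open>rest\<close> after the seam in Y a Y; the mismatch gives two continuations.\<close>
  define w where "w = weave C (replicate t a @ b # g)"
  have Y1: "Y @ b # Y = (pre @ [b]) @ (replicate t a @ b # g) @ Y ! m # drop (Suc m) Y"
    by (subst (1) tl, subst (1) Y_g) simp
  have Y2: "Y @ a # Y = (pre @ b # a # replicate k a) @ (replicate t a @ b # g) @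
      Y ! (m + Suc k) # rest'"
  proof -
    have "replicate t a @ a # replicate k a = a # replicate k a @ replicate t a"
      by (metis replicate_Suc replicate_add add.commute append_Cons)
    moreover have "Y @ a # Y = pre @ b # (replicate t a @ a # replicate k a) @ b # rest"
      by (subst (1) tl, subst (1) hd) simp
    ultimately show ?thesis by (simp add: rest_g)
  qed
  have rs: "rspecial w" unfolding w_def
    by (rule level_rspecial[OF Y1 Y2]) (use mem ne in auto)
  have set_g: "set g \<subseteq> {a, b}" unfolding g_def using set_take_subset[of m Y] Yab by simp
  have "b \<in> set (b # g)" by simp
  then obtain u zs where u: "b # g = u @ b # zs" "b \<notin> set zs" by (meson split_list_last)
  define x where "x = length zs"
  have "set zs \<subseteq> set (b # g)" unfolding u(1) by auto
  hence "set zs \<subseteq> {a}" using u(2) set_g by auto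
  hence zs: "zs = replicate x a" unfolding x_def by (intro replicate_eqI) auto
  \<comment> \<open>Otherwise g ends in k + 1 letters a, which the period below m carries back to
    position k.\<close>
  have xk: "x \<le> k"
  proof (rule ccontr)
    assume xk: "\<not> x \<le> k"
    obtain g0 where g0: "g = g0 @ replicate x a" using u(1) zs by (cases u) auto
    have lg: "length g = m" using mlen by (simp add: g_def)
    have "Y ! j = a" if "m - Suc k \<le> j" "j < m" for j
    proof -
      have "Y ! j = g ! j" using that by (simp add: g_def)
      moreover have "length g0 \<le> j" "j - length g0 < x" using that xk lg by (simp_all add: g0)
      ultimately show ?thesis by (simp add: g0 nth_append)
    qed
    hence "Y ! k = a"
      using run_backwards[of m Y "Suc k" "m - Suc k" a k] per xk lg by (simp add: g0)
    thus False using Yk ab by simp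
  qed
  have w: "replicate t a @ b # g = (replicate t a @ u) @ b # replicate x a" using u zs by simp
  \<comment> \<open>As x \<le> k < t, Y ends in a a^x where the pattern of w ends in b a^x.\<close>
  have L: "Y = (pre @ b # replicate (t - Suc x) a) @ a # replicate x a"
    using xk kt replicate_add[of "t - Suc x" "Suc x" a] by (simp add: tl)
  have "suf (length (weave C (replicate x a)) + length (B 0)) w
      \<noteq> lim_suf (length (weave C (replicate x a)) + length (B 0))"
    unfolding w_def w by (rule level_diverge_lim[OF L]) (use ab in auto)
  moreover have "2 * (length (weave C (replicate x a)) + length (B 0)) \<le> length w + 4 * length (B 0)"
  proof -
    have "x * (length C + a) \<le> t * (length C + a)" using xk kt by (intro mult_le_mono1) simp
    thus ?thesis unfolding w_def w
      by (simp add: length_weave sum_list_replicate algebra_simps)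
  qed
  moreover have "h \<le> length (weave C (replicate x a)) + length (B 0)" "h \<le> length w"
    using h by (simp_all add: length_weave w_def)
  ultimately show ?thesis
    by (intro goodI1[OF rs, of "length (weave C (replicate x a)) + length (B 0)"]) linarith+
qed

text \<open>The seam argument with t = k. The branch spans about k of 2k + 1 copies of C, half a
  copy too few, so it is kept for combination with a second branch.\<close>

lemma rspecial_balanced:
  assumes hd: "Y = replicate k a @ b # rest" and tl: "Y = pre @ b # replicate k a" and k: "k > 0"
  defines "s \<equiv> length (weave C (replicate k a)) + length (B 0)"
  shows "rspecial (weave C (replicate (k + k) a))"
    and "suf s (weave C (replicate (k + k) a)) \<noteq> lim_suf s"
proof -
  have Y1: "Y @ a # Y = (pre @ [b]) @ replicate (k + k) a @ a # b # rest"
    by (subst (1) tl, subst hd) (simp add: replicate_add replicate_app_Cons_same)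
  have Y2: "Y @ a # Y = (pre @ [b, a]) @ replicate (k + k) a @ b # rest"
    by (subst (1) tl, subst hd) (simp add: replicate_add replicate_app_Cons_same)
  show "rspecial (weave C (replicate (k + k) a))"
    by (rule level_rspecial[OF Y1 Y2]) auto
  have w': "replicate (k + k) a = replicate (k - 1) a @ a # replicate k a"
    using k replicate_add[of "k - 1" "Suc k" a] by (simp add: add.commute)
  show "suf s (weave C (replicate (k + k) a)) \<noteq> lim_suf s"
    unfolding w' s_def by (rule level_diverge_lim[OF tl]) (use ab in auto)
qed

text \<open>The long run continues a^(2k+1) by a, the seam of Y a Y by b. The extra copy of C
  compared with a^(2k) makes up the deficit.\<close>

lemma good_if_long_run:
  assumes hd: "Y = replicate k a @ b # rest" and tl: "Y = pre @ b # replicate k a" and k: "k > 0"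
    and run: "Y = p @ replicate (2 * k + 2) a @ p'" and h: "h \<le> length C"
  shows "good h"
proof -
  define w where "w = weave C (replicate (2 * k + 1) a)"
  have Y1: "Y @ a # Y = p @ replicate (2 * k + 1) a @ a # p' @ a # Y"
    by (subst (1) run) (simp add: replicate_app_Cons_same)
  have Y2: "Y @ a # Y = (pre @ [b]) @ replicate (2 * k + 1) a @ b # rest"
    by (subst (1) tl, subst hd) (simp add: replicate_add replicate_app_Cons_same mult_2)
  have rs: "rspecial w" unfolding w_def by (rule level_rspecial[OF Y1 Y2]) auto
  have w': "replicate (2 * k + 1) a = replicate k a @ a # replicate k a"
    using replicate_add[of k "Suc k" a] by (simp add: mult_2)
  have "suf (length (weave C (replicate k a)) + length (B 0)) w
      \<noteq> lim_suf (length (weave C (replicate k a)) + length (B 0))"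
    unfolding w_def w' by (rule level_diverge_lim[OF tl]) (use ab in auto)
  moreover have "2 * (length (weave C (replicate k a)) + length (B 0)) \<le> length w + 4 * length (B 0)"
    by (simp add: w_def length_weave sum_list_replicate algebra_simps)
  moreover have "h \<le> length (weave C (replicate k a)) + length (B 0)" "h \<le> length w"
    using h by (simp_all add: length_weave w_def)
  ultimately show ?thesis
    by (intro goodI1[OF rs, of "length (weave C (replicate k a)) + length (B 0)"]) linarith+
qed

text \<open>The word b a^x is followed by b inside Y and, as x \<le> 2k, by a at the seam of Y a Y.
  Its branch, about one copy of C long, pays the deficit of a^(2k).\<close>

lemma good_if_other_run:
  assumes hd: "Y = replicate k a @ b # rest" and tl: "Y = pre @ b # replicate k a" and k: "k > 0"
    and run: "Y = p @ b # replicate x a @ b # p'" and x: "x \<noteq> k" "x \<le> 2 * k" and h: "h \<le> length C"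
  shows "good h"
proof -
  define w1 where "w1 = weave C (replicate (k + k) a)"
  define w2 where "w2 = weave C (b # replicate x a)"
  define s1 where "s1 = length (weave C (replicate k a)) + length (B 0)"
  define s2 where "s2 = length (weave C (replicate x a)) + length (B 0)"
  note w1 = rspecial_balanced[OF hd tl k, folded w1_def s1_def]
  have Y1: "Y @ a # Y = p @ (b # replicate x a) @ b # p' @ a # Y"
    by (subst (1) run) simp
  have "replicate k a @ a # replicate k a = replicate x a @ a # replicate (2 * k - x) a"
    using x replicate_add[of k "Suc k" a] replicate_add[of x "Suc (2 * k - x)" a] by (simp add: mult_2)
  hence Y2: "Y @ a # Y = pre @ (b # replicate x a) @ a # replicate (2 * k - x) a @ b # rest"
    by (subst (1) tl, subst hd) simp
  have rs2: "rspecial w2" unfolding w2_def by (rule level_rspecial[OF Y1 Y2]) auto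
  have w2: "w2 = weave C ([] @ b # replicate x a)" by (simp add: w2_def)
  have d2: "suf s2 w2 \<noteq> lim_suf s2" if "s2 \<le> length w2"
  \<comment> \<open>For x < k the limit branch has a a^x against b a^x; for x > k it has b a^k
    against a a^k and the separation occurs earlier, at s1.\<close>
  proof (cases "x < k")
    case True
    hence L: "Y = (pre @ b # replicate (k - Suc x) a) @ a # replicate x a"
      using replicate_add[of "k - Suc x" "Suc x" a] by (simp add: tl)
    show ?thesis unfolding w2 s2_def by (rule level_diverge_lim[OF L]) (use ab in auto)
  next
    case False
    hence "b # replicate x a = (b # replicate (x - Suc k) a) @ a # replicate k a"
      using x replicate_add[of "x - Suc k" "Suc k" a] by simp
    hence "w2 = weave C ((b # replicate (x - Suc k) a) @ a # replicate k a)" by (simp only: w2_def)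
    hence "suf s1 w2 \<noteq> lim_suf s1"
      unfolding s1_def by (elim ssubst, intro level_diverge_lim[OF tl]) (use ab in auto)
    moreover have "k * (length C + a) \<le> x * (length C + a)" using False by (intro mult_le_mono1) simp
    hence "s1 \<le> s2"
      by (simp add: s1_def s2_def length_weave sum_list_replicate algebra_simps)
    ultimately show ?thesis using that suf_lim_suf suf_suf by metis
  qed
  have d12: "suf s2 w1 \<noteq> suf s2 w2" if "s2 \<le> length w1"
  proof -
    have "x \<noteq> 2 * k"
    proof
      assume "x = 2 * k"
      hence "length w1 < s2" using B0_ne by (simp add: w1_def s2_def mult_2)
      thus False using that by simp
    qed
    hence "replicate (k + k) a = replicate (k + k - Suc x) a @ a # replicate x a"
      using x replicate_add[of "k + k - Suc x" "Suc x" a] by (simp add: mult_2)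
    hence "w1 = weave C (replicate (k + k - Suc x) a @ a # replicate x a)" by (simp only: w1_def)
    thus ?thesis
      unfolding w2 s2_def by (elim ssubst, intro level_diverge) (use ab in auto)
  qed
  have len: "length w1 = (2 * k + 1) * length C + 2 * k * a"
    "length w2 = (x + 2) * length C + x * a + b"
    "s1 = (k + 1) * length C + k * a + length (B 0)"
    "s2 = (x + 1) * length C + x * a + length (B 0)"
    by (simp_all add: w1_def w2_def s1_def s2_def length_weave sum_list_replicate mult_2)
  \<comment> \<open>Larger than both lengths as x \<le> 2k and b \<le> d. The branches yield about
    \<open>k * (length C + a)\<close> and \<open>length C\<close>, whose doubled sum is q - d -
    1.\<close>
  define q where "q = (2 * k + 2) * length C + 2 * k * a + d + 1"
  have "b \<le> d" using ab by (auto simp: doubleton_eq_iff)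
  have xk: "x * (length C + a) \<le> 2 * k * (length C + a)" using x by (intro mult_le_mono1)
  show ?thesis
  proof (rule goodI2[OF w1(1) rs2, of s1 s2 h q])
    show "length w1 < q" by (simp add: len q_def)
    show "length w2 < q" using xk \<open>b \<le> d\<close> by (simp add: len q_def algebra_simps)
    have "k * (length C + a) + 1 \<le> (length w1 + 1 - s1) + length (B 0)"
      by (simp add: len algebra_simps)
    moreover have "length C + 1 \<le> (length w2 + 1 - s2) + length (B 0)"
      by (simp add: len algebra_simps)
    ultimately show "q \<le> 2 * (length w1 + 1 - s1 + (length w2 + 1 - s2)) + (4 * length (B 0) + d + 2)"
      by (simp add: q_def algebra_simps)
  qed (use w1 d2 d12 h in \<open>auto simp: len\<close>)
qed

text \<open>If \<open>good h\<close> fails, only runs of length k or 2k + 1 remain between letters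
  b. As a^(2k+1) is a^k a a^k, Y parses into copies of a^k with single separators.\<close>

lemma balanced_cases:
  assumes hd: "Y = replicate k a @ b # rest" and tl: "Y = pre @ b # replicate k a" and k: "k > 0"
    and h: "h \<le> length C"
  shows "good h \<or> (\<exists>ys. Y = interleave (replicate k a) ys)"
proof (rule disjCI)
  assume no: "\<nexists>ys. Y = interleave (replicate k a) ys"
  show "good h"
  proof (rule ccontr)
    assume ng: "\<not> good h"
    have Yab: "set Y = {a, b}" using lv ab by (simp add: level_def)
    have "\<exists>ys. R = interleave (replicate k a) ys"
      if "Y = p @ b # R" for p R
      using that
    proof (induction "length R" arbitrary: p R rule: less_induct)
      case less
      have set_R: "set R \<subseteq> {a, b}" using Yab less.prems by auto
      show ?case
      proof (cases "b \<in> set R")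
        case False
        \<comment> \<open>Here R is the final run of Y; after reversal \<open>takeWhile\<close>
          reads it off both factorizations.\<close>
        have tw: "takeWhile (\<lambda>z. z \<noteq> b) (xs @ b # us) = xs" if "b \<notin> set xs" for xs us
          using that by (induction xs) auto
        have "rev R @ b # rev p = replicate k a @ b # rev pre"
          using arg_cong[where f = rev, OF trans[OF less.prems[symmetric] tl]] by simp
        hence "rev R = replicate k a"
          using tw[of "rev R" "rev p"] tw[of "replicate k a" "rev pre"] False ab by simp
        hence "R = replicate k a" by (metis rev_replicate rev_rev_ident)
        thus ?thesis by (intro exI[of _ "[]"]) simp
      next
        case True
        then obtain zs R' where R: "R = zs @ b # R'" "b \<notin> set zs" by (meson split_list_first)
        define x where "x = length zs"
        have "set zs \<subseteq> {a}" using R set_R by auto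
        hence zs: "zs = replicate x a" unfolding x_def by (intro replicate_eqI) auto
        have Y: "Y = p @ b # replicate x a @ b # R'" using less.prems R zs by simp
        have "x = k \<or> x > 2 * k" using good_if_other_run[OF hd tl k Y _ _ h] ng by linarith
        moreover have "x \<le> 2 * k + 1"
        proof (rule ccontr)
          assume "\<not> x \<le> 2 * k + 1"
          hence "x = (2 * k + 2) + (x - (2 * k + 2))" by simp
          hence "replicate x a = replicate (2 * k + 2) a @ replicate (x - (2 * k + 2)) a"
            by (metis replicate_add)
          hence "Y = (p @ [b]) @ replicate (2 * k + 2) a @ (replicate (x - (2 * k + 2)) a @ b # R')"
            using Y by simp
          thus False using good_if_long_run[OF hd tl k _ h] ng by blast
        qed
        ultimately have x: "x = k \<or> x = k + Suc k" by linarith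
        obtain ys where ys: "R' = interleave (replicate k a) ys"
          using less.hyps[of R' "p @ b # replicate x a"] Y R by auto
        show ?thesis using x
        proof
          assume "x = k"
          thus ?thesis using R zs ys by (intro exI[of _ "b # ys"]) (simp add: interleave_Cons)
        next
          assume "x = k + Suc k"
          thus ?thesis using R zs ys
            by (intro exI[of _ "a # b # ys"]) (simp add: interleave_Cons replicate_add replicate_app_Cons_same)
        qed
      qed
    qed
    from this[OF hd] obtain ys where "rest = interleave (replicate k a) ys" by blast
    hence "Y = interleave (replicate k a) (b # ys)" by (simp add: hd interleave_Cons)
    thus False using no by blast
  qed
qed

end

section \<open>Surplus along the tower\<close>

lemma level_decomp:
  assumes "level C Y"
  obtains a b k rest pre t where "a \<noteq> b" "{a, b} = {0, d}" "k > 0"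
    "Y = replicate k a @ b # rest" "Y = pre @ b # replicate t a"
proof -
  have Y: "set Y = {0, d}" using assms by (simp add: level_def)
  \<comment> \<open>With a as the first spacer the initial run is nonempty; the final run may be
    empty.\<close>
  define a where "a = hd Y"
  have "Y \<noteq> []" using Y by auto
  hence "a \<in> {0, d}" unfolding a_def Y[symmetric] by simp
  then obtain b where ab: "a \<noteq> b" "{a, b} = {0, d}" using d_pos by auto
  have b: "b \<in> set Y" using Y ab by auto
  have rep: "zs = replicate (length zs) a" if "set zs \<subseteq> set Y" "b \<notin> set zs" for zs
    using that Y ab by (intro replicate_eqI) auto
  obtain zs rest where 1: "Y = zs @ b # rest" "b \<notin> set zs" using b by (meson split_list_first)
  obtain pre zs' where 2: "Y = pre @ b # zs'" "b \<notin> set zs'" using b by (meson split_list_last)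
  have "zs \<noteq> []" using 1 ab by (auto simp: a_def)
  show ?thesis
  proof (rule that[OF ab])
    show "length zs > 0" using \<open>zs \<noteq> []\<close> by simp
    show "Y = replicate (length zs) a @ b # rest" using rep[of zs] 1 by auto
    show "Y = pre @ b # replicate (length zs') a" using rep[of zs'] 2 by auto
  qed
qed

lemma level_B: "level (B n) (P n)"
  unfolding level_def
proof (intro conjI ballI)
  show "\<exists>u. B n = u @ B 0" by (rule suffix_B) simp
  show "\<exists>m. weave (B n) (P n) = B m" using B_Suc by metis
  show "weave (B n) (P n @ z # P n) \<in> lang" if "z \<in> {0, d}" for z
    using B_pair_in_lang[OF that, of "Suc n"] by (simp add: weave_append B_Suc)
qed (simp_all add: B_hd set_P)

text \<open>The word ys may be constant; combining it with the next pattern makes both spacers occur.\<close>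

lemma level_interleave:
  assumes P: "P n = interleave Q ys" and Q: "set Q \<subseteq> {0, d}"
  shows "level (weave (B n) Q) (interleave ys (P (Suc n)))"
proof -
  have B: "weave (weave (B n) Q) ys = B (Suc n)" by (simp add: B_Suc P weave_interleave)
  have "set ys \<subseteq> set (P n)" unfolding P by (auto simp: interleave_def)
  hence set_Y: "set (interleave ys (P (Suc n))) = {0, d}"
    using set_P[of n] set_P[of "Suc n"] by (auto simp: interleave_def)
  obtain u where u: "B n = u @ B 0" using suffix_B[of 0 n] by auto
  have suffix: "\<exists>u. weave (B n) Q = u @ B 0"
    by (cases Q rule: rev_cases) (auto simp: u weave_append)
  have "interleave ys (P (Suc n) @ z # P (Suc n)) =
      interleave ys (P (Suc n)) @ z # interleave ys (P (Suc n))" for z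
    by (simp add: interleave_append)
  hence "weave (weave (B n) Q) (interleave ys (P (Suc n)) @ z # interleave ys (P (Suc n)))
      = weave (B (Suc n)) (P (Suc n) @ z # P (Suc n))" for z
    by (metis weave_interleave B)
  moreover have "weave (weave (B n) Q) (interleave ys (P (Suc n))) = B (Suc (Suc n))"
    unfolding weave_interleave B B_Suc[symmetric] by simp
  moreover have "hd (weave (B n) Q) = 0" using B_hd B_ne by (simp add: weave_def)
  ultimately show ?thesis
    using set_Y suffix level_B[of "Suc n"] unfolding level_def by auto
qed

lemma good_B: "good (length (B n))"
proof -
  let ?h = "length (B n)"
  obtain a b k rest pre t where ab: "a \<noteq> b" "{a, b} = {0, d}" and k: "k > 0"
    and P: "P n = replicate k a @ b # rest" "P n = pre @ b # replicate t a"
    by (rule level_decomp[OF level_B])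
  consider "t < k" | "k < t" | "t = k" by linarith
  thus ?thesis
  proof cases
    case 1
    show ?thesis using good_if_head_longer[OF level_B ab P 1] by simp
  next
    case 2
    show ?thesis using good_if_tail_longer[OF level_B ab P 2] by simp
  next
    case 3
    note P' = P[unfolded 3]
    define C where "C = weave (B n) (replicate k a)"
    define w1 where "w1 = weave (B n) (replicate (k + k) a)"
    define s1 where "s1 = length C + length (B 0)"
    note w1 = rspecial_balanced[OF level_B ab P' k, folded C_def, folded w1_def s1_def]
    \<comment> \<open>Goodness stays at the length of the old block even when the regrouped level
      over C supplies the branch.\<close>
    have hC: "?h \<le> length C" by (simp add: C_def length_weave)
    from balanced_cases[OF level_B ab P' k order_refl] show ?thesis
    proof (elim disjE exE)
      fix ys assume ys: "P n = interleave (replicate k a) ys"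
      define Y where "Y = interleave ys (P (Suc n))"
      have lv: "level C Y" unfolding C_def Y_def
        by (rule level_interleave[OF ys]) (use ab in \<open>auto simp: set_replicate_conv_if\<close>)
      obtain a' b' k' rest' pre' t' where ab': "a' \<noteq> b'" "{a', b'} = {0, d}" and k': "k' > 0"
        and Y: "Y = replicate k' a' @ b' # rest'" "Y = pre' @ b' # replicate t' a'"
        by (rule level_decomp[OF lv])
      consider "t' < k'" | "k' < t'" | "t' = k'" by linarith
      thus ?thesis
      proof cases
        case 1
        show ?thesis using good_if_head_longer[OF lv ab' Y 1 hC] .
      next
        case 2
        show ?thesis using good_if_tail_longer[OF lv ab' Y 2 hC] .
      next
        case 3
        note Y' = Y[unfolded 3]
        define w2 where "w2 = weave C (replicate (k' + k') a')"
        define s2 where "s2 = length (weave C (replicate k' a')) + length (B 0)"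
        note w2 = rspecial_balanced[OF lv ab' Y' k', folded w2_def s2_def]
        have len: "length w1 = (2 * k + 1) * ?h + 2 * k * a"
          "length w2 = (2 * k' + 1) * length C + 2 * k' * a'"
          "s1 = length C + length (B 0)"
          "s2 = (k' + 1) * length C + k' * a' + length (B 0)"
          "length C = (k + 1) * ?h + k * a"
          by (simp_all add: w1_def w2_def s1_def s2_def length_weave sum_list_replicate C_def mult_2)
        have "length C \<le> k' * length C" using k' by simp
        hence s2: "2 * length C + length (B 0) \<le> s2" and lw: "3 * length C \<le> length w2"
          unfolding len(2,4) add_mult_distrib mult.assoc by linarith+
        \<comment> \<open>\<open>w1\<close> is shorter than \<open>s2\<close>, so the branches
          occupy disjoint ranges and the condition comparing them is vacuous.\<close>
        have w1C: "length w1 < 2 * length C"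
          using B_ne[of n] by (simp add: len(1,5) algebra_simps)
        \<comment> \<open>By k > 0, \<open>length C\<close> is at most twice k copies of
          \<open>B n\<close> with their spacers, which is the yield of \<open>w1\<close> up to
          \<open>length (B 0)\<close>.\<close>
        have C1: "length C \<le> 2 * (length w1 + 1 - s1) + 2 * length (B 0)"
        proof -
          have "k * ?h + k * a \<le> length w1 + 1 - s1 + length (B 0)"
            by (simp add: len(1,3,5) algebra_simps)
          moreover have "?h \<le> k * ?h" using k by simp
          moreover have "length C = ?h + k * ?h + k * a" by (simp add: len(5))
          ultimately show ?thesis by linarith
        qed
        \<comment> \<open>After doubling, the regrouped level falls short by one
          \<open>length C\<close>, which \<open>C1\<close> supplies.\<close>
        have C2: "length w2 + 1 \<le> 2 * (length w2 + 1 - s2) + length C + 2 * length (B 0)"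
          by (simp add: len(2,4) algebra_simps)
        show ?thesis
        proof (rule goodI2[OF w1(1) w2(1), of s1 s2 ?h "length w2 + 1"])
          show "length w2 + 1 \<le> 2 * (length w1 + 1 - s1 + (length w2 + 1 - s2)) + (4 * length (B 0) + d + 2)"
            using C1 C2 by (simp add: algebra_simps)
        qed (use w1 w2 s2 lw w1C hC in \<open>auto simp: s1_def w1_def length_weave\<close>)
      qed
    qed
  qed
qed

text \<open>At a level whose block is longer than the constant, goodness forces a positive sum; such
  levels exist beyond any range already used.\<close>

lemma sum_RS_unbounded: "\<exists>n\<ge>n0. M \<le> (\<Sum>l<length (B n). card (RS l) - 1)"
proof (induction M)
  case (Suc M)
  then obtain n where n: "n \<ge> n0" "M \<le> (\<Sum>l<length (B n). card (RS l) - 1)" by blast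
  define n' where "n' = max n (4 * length (B 0) + d + 2)"
  have n': "length (B n) \<le> length (B n')" by (intro length_B_mono) (simp add: n'_def)
  obtain q where q: "q \<ge> length (B n')"
      "q \<le> 2 * (\<Sum>l=length (B n')..<q. card (RS l) - 1) + (4 * length (B 0) + d + 2)"
    using good_B[of n'] unfolding good_def by blast
  have "length (B n') > 4 * length (B 0) + d + 2" using length_B[of n'] by (simp add: n'_def)
  hence 1: "(\<Sum>l=length (B n')..<q. card (RS l) - 1) \<ge> 1" using q by linarith
  have "Suc M \<le> (\<Sum>l<length (B n). card (RS l) - 1) + (\<Sum>l=length (B n')..<q. card (RS l) - 1)"
    using n 1 by linarith
  also have "\<dots> = (\<Sum>l\<in>{..<length (B n)} \<union> {length (B n')..<q}. card (RS l) - 1)"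
    using n' by (intro sum.union_disjoint[symmetric]) auto
  also have "\<dots> \<le> (\<Sum>l<length (B (max q n)). card (RS l) - 1)"
    using q n' length_B[of "max q n"] length_B_mono[of n "max q n"] by (intro sum_mono2) auto
  finally show ?case using n(1) by (intro exI[of _ "max q n"]) auto
qed auto

text \<open>The limit branch gives q, lengths below \<open>length (B n)\<close> give M more, and the
  remaining range gives q / 2 up to the constant.\<close>

lemma card_words_unbounded:
  "\<exists>q\<ge>q0. 3 * q + 2 * M \<le> 2 * card {w. length w = q \<and> w \<in> lang} + (4 * length (B 0) + d + 2)"
proof -
  obtain n where n: "n \<ge> q0" "M \<le> (\<Sum>l<length (B n). card (RS l) - 1)"
    using sum_RS_unbounded by blast
  obtain q where q: "q \<ge> length (B n)"
      "q \<le> 2 * (\<Sum>l=length (B n)..<q. card (RS l) - 1) + (4 * length (B 0) + d + 2)"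
    using good_B[of n] unfolding good_def by blast
  have "(\<Sum>l<q. card (RS l) - 1) =
      (\<Sum>l<length (B n). card (RS l) - 1) + (\<Sum>l=length (B n)..<q. card (RS l) - 1)"
    using q(1) by (simp add: lessThan_atLeast0 sum.atLeastLessThan_concat)
  hence "3 * q + 2 * M \<le> 2 * card {w. length w = q \<and> w \<in> lang} + (4 * length (B 0) + d + 2)"
    using card_words_ge[of q] q(2) n(2) by linarith
  moreover have "q0 \<le> q" using n(1) q(1) length_B[of n] by linarith
  ultimately show ?thesis by blast
qed

end

section \<open>From blocks to the subshift\<close>

text \<open>Place \<open>A 0\<close> at position 0; every step grows on both sides, so each integer
  position is eventually covered.\<close>

lemma bi_infinite_extension:
  fixes A u v :: "nat \<Rightarrow> 'a list"
  assumes A: "\<And>j. A (Suc j) = u j @ A j @ v j" and u: "\<And>j. u j \<noteq> []" and v: "\<And>j. v j \<noteq> []"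
  obtains x :: "int \<Rightarrow> 'a" where "\<And>i. \<exists>j. x i \<in> set (A j)"
    and "\<And>i q. \<exists>j. sublist (map (\<lambda>l. x (i + int l)) [0..<q]) (A j)"
    and "map (\<lambda>l. x (int l)) [0..<length (A 0)] = A 0"
proof -
  define off where "off j = (\<Sum>i<j. length (u i))" for j
  have off: "off (Suc j) = length (u j) + off j" for j by (simp add: off_def)
  have off_ge: "j \<le> off j" for j
  proof (induction j)
    case (Suc j)
    have "length (u j) > 0" using u by simp
    thus ?case using Suc off[of j] by linarith
  qed simp
  have len_ge: "off j + j \<le> length (A j)" for j
  proof (induction j)
    case (Suc j)
    have "length (v j) > 0" using v by simp
    thus ?case using Suc off[of j] by (simp only: A length_append)
  qed (simp add: off_def)
  \<comment> \<open>\<open>A j\<close> begins at position \<open>- off j\<close> and reaches at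
    least to j - 1, so index \<bar>i\<bar> + 1 covers i.\<close>
  define x where "x i = A (Suc (nat \<bar>i\<bar>)) ! nat (i + int (off (Suc (nat \<bar>i\<bar>))))" for i
  have inside: "0 \<le> i + int (off j) \<and> nat (i + int (off j)) < length (A j)" if "\<bar>i\<bar> < int j" for i j
    using off_ge[of j] len_ge[of j] that by linarith
  have x: "x i = A j ! nat (i + int (off j))" if "Suc (nat \<bar>i\<bar>) \<le> j" for i j
    using that
  proof (induction rule: dec_induct)
    case (step j)
    have "nat (i + int (off (Suc j))) = length (u j) + nat (i + int (off j))"
      using inside[of i j] step.hyps off[of j] by linarith
    thus ?case using step inside[of i j] by (simp add: A nth_append)
  qed (simp add: x_def)
  show ?thesis
  proof (rule that[of x])
    fix i
    show "\<exists>j. x i \<in> set (A j)"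
      using inside[of i "Suc (nat \<bar>i\<bar>)"] by (intro exI[of _ "Suc (nat \<bar>i\<bar>)"]) (simp add: x_def)
  next
    fix i q
    define j where "j = Suc (nat \<bar>i\<bar> + q)"
    have bound: "nat (i + int (off j)) + q \<le> length (A j)" "0 \<le> i + int (off j)"
      using off_ge[of j] len_ge[of j] unfolding j_def by linarith+
    have "map (\<lambda>l. x (i + int l)) [0..<q] = take q (drop (nat (i + int (off j))) (A j))"
    proof (rule nth_equalityI)
      fix l assume "l < length (map (\<lambda>l. x (i + int l)) [0..<q])"
      hence l: "l < q" by simp
      have "x (i + int l) = A j ! nat (i + int l + int (off j))"
        using l by (intro x) (simp add: j_def)
      also have "nat (i + int l + int (off j)) = nat (i + int (off j)) + l" using bound by simp
      finally show "map (\<lambda>l. x (i + int l)) [0..<q] ! l = take q (drop (nat (i + int (off j))) (A j)) ! l"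
        using l bound by simp
    qed (use bound in simp)
    moreover have "sublist (take q (drop m (A j))) (A j)" for m
      by (meson sublist_take sublist_drop sublist_order.order_trans)
    ultimately show "\<exists>j. sublist (map (\<lambda>l. x (i + int l)) [0..<q]) (A j)" by metis
  next
    show "map (\<lambda>l. x (int l)) [0..<length (A 0)] = A 0"
    proof (rule nth_equalityI)
      fix l assume "l < length (map (\<lambda>l. x (int l)) [0..<length (A 0)])"
      hence l: "l < length (A 0)" by simp
      have "A j ! (l + off j) = A 0 ! l \<and> l + off j < length (A j)" for j
      proof (induction j)
        case (Suc j)
        have "A (Suc j) ! (l + off (Suc j)) = (A j @ v j) ! (l + off j)"
          by (simp add: A off nth_append)
        thus ?case using Suc by (simp add: nth_append A off)
      qed (use l in \<open>simp add: off_def\<close>)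
      thus "map (\<lambda>l. x (int l)) [0..<length (A 0)] ! l = A 0 ! l"
        using l x[of "int l" "Suc l"] by (simp add: nat_int_add)
    qed simp
  qed
qed

theorem theorem3p1:
  fixes r :: "nat \<Rightarrow> nat" and s :: "nat \<Rightarrow> nat \<Rightarrow> nat"
  assumes r_pos: "\<And>n. n \<ge> 1 \<Longrightarrow> r n > 0"
    and spacers: "\<exists>d::nat. d > 0 \<and> (\<exists>N. \<forall>n\<ge>N.
        s n (r n) = 0 \<and> (\<forall>i<r n. s n i \<in> {0, d}) \<and>
        \<not> (\<forall>i<r n. \<forall>j<r n. s n i = s n j))"
  shows "limsup (\<lambda>q. ereal (real (complexity (rank_one_subshift r s) q) - 1.5 * real q)) = \<infinity>"
proof -
  obtain d N where d: "d > 0" and N: "\<And>n. n \<ge> N \<Longrightarrow> s n (r n) = 0"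
      "\<And>n i. n \<ge> N \<Longrightarrow> i < r n \<Longrightarrow> s n i \<in> {0, d}"
      "\<And>n. n \<ge> N \<Longrightarrow> \<not> (\<forall>i<r n. \<forall>j<r n. s n i = s n j)"
    using spacers by blast
  \<comment> \<open>\<open>blk r s m\<close> is the block numbered m + 1, so passing from
    \<open>A k\<close> to \<open>A (Suc k)\<close> uses stage \<open>Suc (N + k)\<close>, where the
    hypotheses hold.\<close>
  define A where "A k = blk r s (N + k)" for k
  define P where "P k = map (s (Suc (N + k))) [0..<r (Suc (N + k))]" for k
  have blk_binary: "set (blk r s k) \<subseteq> {0, 1}" for k
    by (induction k) auto
  have blk_hd: "blk r s k \<noteq> [] \<and> hd (blk r s k) = 0" for k
    by (induction k) (auto simp: upt_conv_Cons simp del: upt_Suc)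
  have weave_map: "concat (map (\<lambda>i. C @ replicate (f i) 1) [0..<m]) @ C = weave C (map f [0..<m])"
    for C :: "nat list" and f and m :: nat
    by (induction m) (simp_all add: weave_append2)
  interpret tower A P d
  proof
    fix k
    show "A (Suc k) = weave (A k) (P k)"
      using N(1)[of "Suc (N + k)"] weave_map[of "A k" "s (Suc (N + k))"]
      by (simp add: A_def P_def)
    have "set (P k) \<subseteq> {0, d}" using N(2)[of "Suc (N + k)"] by (simp add: P_def image_subset_iff)
    moreover have "\<not> set (P k) \<subseteq> {z}" for z
    proof
      assume "set (P k) \<subseteq> {z}"
      hence "\<forall>i<r (Suc (N + k)). s (Suc (N + k)) i = z" by (simp add: P_def image_subset_iff)
      thus False using N(3)[of "Suc (N + k)"] by simp
    qed
    ultimately show "set (P k) = {0, d}" by blast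
  qed (use d blk_binary blk_hd in \<open>auto simp: A_def\<close>)
  let ?X = "rank_one_subshift r s"
  have words: "w \<in> {w. length w = q \<and> (\<exists>x\<in>?X. \<exists>i. w = win x i q)}" if w: "w \<in> lang" and q: "length w = q" for w q
  proof -
    obtain k p p' where k: "A k = p @ w @ p'" using w by (auto simp: lang_def sublist_def)
    \<comment> \<open>\<open>P j\<close> contains both spacers, so \<open>A (Suc j)\<close> has at
      least three copies of \<open>A j\<close>; the second has nonempty words on both sides.\<close>
    have "\<exists>u v. u \<noteq> [] \<and> v \<noteq> [] \<and> A (Suc j) = u @ A j @ v" for j
    proof -
      have "card (set (P j)) = 2" using set_P[of j] d_pos by simp
      then obtain y y' ys where "P j = y # y' # ys"
        by (cases "P j" rule: remdups_adj.cases) auto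
      hence "A (Suc j) = (A j @ replicate y 1) @ A j @ replicate y' 1 @ weave (A j) ys"
        by (simp add: B_Suc weave_Cons)
      moreover have "weave (A j) ys \<noteq> []" using B_ne by (simp add: weave_def)
      ultimately show ?thesis using B_ne by blast
    qed
    then obtain u v where uv: "\<And>j. u j \<noteq> []" "\<And>j. v j \<noteq> []" "\<And>j. A (Suc j) = u j @ A j @ v j"
      by metis
    obtain x where x: "\<And>i. \<exists>j. x i \<in> set (A (k + j))"
      "\<And>i q. \<exists>j. sublist (map (\<lambda>l. x (i + int l)) [0..<q]) (A (k + j))"
      "map (\<lambda>l. x (int l)) [0..<length (A k)] = A k"
      by (rule bi_infinite_extension[of "\<lambda>j. A (k + j)" "\<lambda>j. u (k + j)" "\<lambda>j. v (k + j)"])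
        (use uv in auto)
    have "x \<in> ?X"
    proof -
      have "x i \<in> {0, 1}" for i using x(1)[of i] B_binary by blast
      moreover have "\<exists>n\<ge>1. sublist (win x i q) (Defs.B r s n)" for i q
      proof -
        obtain j where "sublist (win x i q) (A (k + j))" using x(2)[of i q] by (auto simp: win_def)
        thus ?thesis by (intro exI[of _ "Suc (N + (k + j))"]) (simp add: Defs.B_def A_def)
      qed
      ultimately show ?thesis by (simp add: rank_one_subshift_def)
    qed
    moreover have "w = win x (int (length p)) q"
    proof (rule nth_equalityI)
      fix l assume l: "l < length w"
      have "x (int (length p + l)) = A k ! (length p + l)"
        using arg_cong[where f = "\<lambda>xs. xs ! (length p + l)", OF x(3)] l k by simp
      thus "w ! l = win x (int (length p)) q ! l" using l q by (simp add: k win_def nth_append)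
    qed (simp add: win_def q)
    ultimately show ?thesis using q by blast
  qed
  have complexity_ge: "card {w. length w = q \<and> w \<in> lang} \<le> complexity ?X q" for q
    unfolding complexity_def
  proof (rule card_mono)
    show "finite {w. length w = q \<and> (\<exists>x\<in>?X. \<exists>i. w = win x i q)}"
    proof (rule finite_subset)
      show "{w. length w = q \<and> (\<exists>x\<in>?X. \<exists>i. w = win x i q)} \<subseteq> {w. set w \<subseteq> {0, 1} \<and> length w = q}"
      proof
        fix w assume "w \<in> {w. length w = q \<and> (\<exists>x\<in>?X. \<exists>i. w = win x i q)}"
        then obtain x i where "x \<in> ?X" "w = win x i q" by blast
        thus "w \<in> {w. set w \<subseteq> {0, 1} \<and> length w = q}"
          by (simp add: rank_one_subshift_def win_def image_subset_iff)
      qed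
    qed (simp add: finite_lists_length_eq)
  qed (use words in blast)
  have unbounded: "\<exists>q\<ge>q0. real c \<le> real (complexity ?X q) - 1.5 * real q" for q0 c
  proof -
    \<comment> \<open>A surplus of c + K still leaves at least 2c after the constant K is
      subtracted.\<close>
    define K where "K = 4 * length (A 0) + d + 2"
    obtain q where q: "q \<ge> q0" "3 * q + 2 * (c + K) \<le> 2 * card {w. length w = q \<and> w \<in> lang} + K"
      using card_words_unbounded[of q0 "c + K"] unfolding K_def by blast
    have "3 * q + 2 * (c + K) \<le> 2 * complexity ?X q + K"
      using q(2) complexity_ge[of q] by (meson add_le_mono1 mult_le_mono2 order_trans)
    hence "3 * q + 2 * c \<le> 2 * complexity ?X q" by (simp add: algebra_simps)
    hence "3 * real q + 2 * real c \<le> 2 * real (complexity ?X q)" by linarith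
    thus ?thesis using q(1) by (intro exI[of _ q]) simp
  qed
  have "(SUP q\<in>{q0..}. ereal (real (complexity ?X q) - 1.5 * real q)) = \<infinity>" for q0
  proof (rule SUP_PInfty)
    fix c :: nat
    obtain q where "q \<ge> q0" "real c \<le> real (complexity ?X q) - 1.5 * real q" using unbounded by blast
    thus "\<exists>q\<in>{q0..}. ereal (real c) \<le> ereal (real (complexity ?X q) - 1.5 * real q)"
      by (intro bexI[of _ q]) auto
  qed
  thus ?thesis by (simp add: limsup_INF_SUP)
qed

end
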